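(* Let $P$ be a poset. Then $P\in\mathcal{L}_{\mathcal{S}}(<\omega)$ if and only if $B(P)\in\mathcal{L}_{\mathcal{S}}(<\omega)$.
   Context: A poset (or its order) is scattered if it contains no induced subposet isomorphic to the chain of rational numbers. $\mathcal{L}_{\mathcal{S}}(<\omega)$ is the class of posets whose order is the intersection of finitely many scattered linear orders on the underlying set. For a poset $P$, the split $B(P)$ is the poset with underlying set $P\times\{0,1\}$ and strict order $(x,i)<(y,j)$ iff $x\leq y$ in $P$ and $i<j$. *)

theory Defs
  imports Complex_Main
begin

text \<open>
  A poset is given by a carrier \<open>A\<close> and a reflexive order relation \<open>r\<close> with
  \<open>partial_order_on A r\<close>; in particular \<open>r \<subseteq> A \<times> A\<close>.
\<close>

definition scattered_on :: "'a set \<Rightarrow> 'a rel \<Rightarrow> bool" where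
  "scattered_on A r \<longleftrightarrow>
     \<not> (\<exists>S \<subseteq> A. \<exists>f :: rat \<Rightarrow> 'a.
          bij_betw f UNIV S \<and> (\<forall>p q. p \<le> q \<longleftrightarrow> (f p, f q) \<in> r))"

text \<open>
  The family of linear orders must be nonempty, since \<open>\<Inter>{}\<close> is \<open>UNIV\<close>.
\<close>

definition finite_scattered_dim :: "'a set \<Rightarrow> 'a rel \<Rightarrow> bool" where
  "finite_scattered_dim A r \<longleftrightarrow>
     partial_order_on A r \<and>
     (\<exists>\<L>. finite \<L> \<and> \<L> \<noteq> {} \<and>
        (\<forall>L \<in> \<L>. linear_order_on A L \<and> scattered_on A L) \<and> r = \<Inter>\<L>)"

definition split_carrier :: "'a set \<Rightarrow> ('a \<times> nat) set" where
  "split_carrier A = A \<times> {0, 1}"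

text \<open>The split is specified by its strict order, of which this is the reflexive closure.\<close>

definition split_order :: "'a set \<Rightarrow> 'a rel \<Rightarrow> ('a \<times> nat) rel" where
  "split_order A r =
     {((x, i), (y, j)) | x i y j.
        (x, i) \<in> split_carrier A \<and> (y, j) \<in> split_carrier A \<and>
        ((x, i) = (y, j) \<or> (x, y) \<in> r \<and> i < j)}"

lemma partial_order_on_split:
  "partial_order_on (split_carrier A) (split_order A r)"
  unfolding partial_order_on_def preorder_on_def refl_on_def trans_def antisym_def
    split_order_def split_carrier_def
  by auto

end

theory Submission
  imports Defs "HOL-Library.Countable"
begin

text \<open>
  If \<open>P\<close> is the intersection of scattered linear orders \<open>L\<close>, then \<open>B(P)\<close> is the intersection of
  the lexicographic orders (first \<open>L\<close>, then \<open>0 < 1\<close>) and of one further linear order, which puts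
  \<open>P \<times> {0}\<close> below \<open>P \<times> {1}\<close> and orders both levels by the converse of one of the \<open>L\<close>.

  Conversely, let \<open>B(P)\<close> be the intersection of the scattered linear orders \<open>L\<^sub>1, \<dots>, L\<^sub>n\<close>. Let
  \<open>D\<^sub>i(x)\<close> be the initial segment of \<open>L\<^sub>i\<close> generated by all \<open>(z, 0)\<close> with \<open>z \<le> x\<close>. Then \<open>x \<le> y\<close> implies
  \<open>D\<^sub>i(x) \<subseteq> D\<^sub>i(y)\<close> for all \<open>i\<close>; and if \<open>x \<le> y\<close> fails, then \<open>(y, 1)\<close> is below \<open>(x, 0)\<close> in some \<open>L\<^sub>i\<close>, so that
  \<open>D\<^sub>i(y)\<close> is a proper subset of \<open>D\<^sub>i(x)\<close>. Hence \<open>P\<close> is the intersection of the linear orders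
  \<open>M\<^sub>i\<close> comparing \<open>(D\<^sub>i, D\<^sub>1, \<dots>, D\<^sub>n)\<close> lexicographically. Initial segments of a scattered chain form a
  scattered chain, and a lexicographic combination of finitely many scattered total preorders is
  scattered because every interval of the rationals contains a copy of the rationals.
\<close>

section \<open>Copies of the rationals in preorders\<close>

text \<open>Only the strict part of \<open>R\<close> counts, so the notion also fits preorders with
  ties, where it means a copy of the rationals in the quotient by ties.\<close>

definition rat_embeds :: "'a rel \<Rightarrow> bool" where
  "rat_embeds R \<longleftrightarrow> (\<exists>f :: rat \<Rightarrow> 'a. \<forall>p q. p < q \<longrightarrow> (f p, f q) \<in> R \<and> (f q, f p) \<notin> R)"

lemma rat_embedsI:
  fixes f :: "rat \<Rightarrow> 'a"
  assumes "\<And>p q. p < q \<Longrightarrow> (f p, f q) \<in> R \<and> (f q, f p) \<notin> R"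
  shows "rat_embeds R"
  unfolding rat_embeds_def using assms by blast

text \<open>Trichotomy of the rationals makes a strictly increasing map reflect the order as well,
  so it is an isomorphism onto its range.\<close>

lemma scattered_on_iff_not_rat_embeds:
  assumes "linear_order_on A L"
  shows "scattered_on A L \<longleftrightarrow> \<not> rat_embeds L"
proof -
  have sub: "L \<subseteq> A \<times> A" and refl: "refl_on A L" and anti: "antisym L"
    using assms
    by (auto simp: linear_order_on_def partial_order_on_def preorder_on_def)
  have "rat_embeds L" if f: "\<forall>p q. p \<le> q \<longleftrightarrow> (f p, f q) \<in> L" for f :: "rat \<Rightarrow> 'a"
    using f by (intro rat_embedsI[of f]) (metis less_le_not_le)
  moreover have "\<exists>S\<subseteq>A. \<exists>f :: rat \<Rightarrow> 'a. bij_betw f UNIV S \<and> (\<forall>p q. p \<le> q \<longleftrightarrow> (f p, f q) \<in> L)"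
    if emb: "rat_embeds L"
  proof -
    obtain f :: "rat \<Rightarrow> 'a" where f: "\<And>p q. p < q \<Longrightarrow> (f p, f q) \<in> L \<and> (f q, f p) \<notin> L"
      using emb unfolding rat_embeds_def by blast
    have A: "f q \<in> A" for q
      using f[of q "q + 1"] sub by auto
    have iff: "p \<le> q \<longleftrightarrow> (f p, f q) \<in> L" for p q
      using f[of p q] f[of q p] refl_onD[OF refl A] by (cases p q rule: linorder_cases) auto
    have "inj f"
      using iff by (intro injI) (metis order.antisym order_refl)
    then have "bij_betw f UNIV (range f)"
      by (simp add: bij_betw_def)
    then show ?thesis
      using A iff by blast
  qed
  ultimately show ?thesis
    unfolding scattered_on_def by blast
qed

lemma rat_embeds_converse:
  assumes "rat_embeds (R\<inverse>)"
  shows "rat_embeds R"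
proof -
  obtain f :: "rat \<Rightarrow> 'a" where f: "\<And>p q. p < q \<Longrightarrow> (f q, f p) \<in> R \<and> (f p, f q) \<notin> R"
    using assms unfolding rat_embeds_def by auto
  show ?thesis
    by (rule rat_embedsI[of "\<lambda>q. f (- q)"]) (simp add: f)
qed

lemma rat_embeds_inv_image:
  assumes "rat_embeds ((A \<times> A) \<inter> inv_image R g)"
  shows "rat_embeds R"
proof -
  obtain f :: "rat \<Rightarrow> 'a" where f: "\<And>p q. p < q \<Longrightarrow>
      (f p, f q) \<in> (A \<times> A) \<inter> inv_image R g \<and> (f q, f p) \<notin> (A \<times> A) \<inter> inv_image R g"
    using assms unfolding rat_embeds_def by blast
  show ?thesis
  proof (rule rat_embedsI)
    fix p q :: rat assume "p < q"
    from f[OF this] show "((g \<circ> f) p, (g \<circ> f) q) \<in> R \<and> ((g \<circ> f) q, (g \<circ> f) p) \<notin> R"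
      by (auto simp: inv_image_def)
  qed
qed

lemma rat_strict_mono_into_interval:
  fixes a b :: rat
  assumes "a < b"
  obtains g :: "rat \<Rightarrow> rat" where "strict_mono g" "\<And>q. a < g q \<and> g q < b"
proof -
  \<comment> \<open>An increasing map of the rationals into the interval from -1 to 1, which an
    affine map then carries to the one from \<open>a\<close> to \<open>b\<close>.\<close>
  define h :: "rat \<Rightarrow> rat" where "h q = q / (1 + \<bar>q\<bar>)" for q
  have h: "h p < h q" if "p < q" for p q
  proof -
    have pos: "0 < 1 + \<bar>p\<bar>" "0 < 1 + \<bar>q\<bar>" by linarith+
    have "p * \<bar>q\<bar> \<le> q * \<bar>p\<bar>"
      using that mult_nonpos_nonneg[of p q]
      by (cases "p \<ge> 0"; cases "q \<ge> 0") (simp_all add: mult.commute)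
    then have "p * (1 + \<bar>q\<bar>) < q * (1 + \<bar>p\<bar>)"
      using that by (simp add: distrib_left)
    then show ?thesis
      using pos unfolding h_def by (simp add: divide_simps)
  qed
  have bound: "- 1 < h q \<and> h q < 1" for q
  proof -
    have "0 < 1 + \<bar>q\<bar>" by linarith
    then show ?thesis
      unfolding h_def by (simp add: pos_less_divide_eq pos_divide_less_eq) linarith
  qed
  show thesis
  proof
    show "strict_mono (\<lambda>q. (a + b) / 2 + (b - a) / 2 * h q)"
      using assms h by (intro strict_monoI) simp
    show "a < (a + b) / 2 + (b - a) / 2 * h q \<and> (a + b) / 2 + (b - a) / 2 * h q < b" for q
    proof -
      have "(b - a) / 2 * (- 1) < (b - a) / 2 * h q" "(b - a) / 2 * h q < (b - a) / 2 * 1"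
        using assms bound[of q] by (intro mult_strict_left_mono; simp)+
      then show ?thesis by (simp add: field_simps)
    qed
  qed
qed

text \<open>The rationals contain a copy of their lexicographic product with a two-element chain.\<close>

lemma rat_disjoint_intervals:
  obtains a b :: "rat \<Rightarrow> rat" where "\<And>q. a q < b q" "\<And>p q. p < q \<Longrightarrow> b p < a q"
proof -
  \<comment> \<open>Each rational carries the positive total weight of its indices in an
    enumeration. Summing the weights below \<open>q\<close>, without and with that of
    \<open>q\<close>, gives the ends of an open real gap belonging to \<open>q\<close>; gaps of
    distinct rationals are disjoint.\<close>
  define e :: "nat \<Rightarrow> rat" where "e = from_nat"
  define lo where "lo q = (\<Sum>n. if e n < q then (1/2::real) ^ n else 0)" for q
  define hi where "hi q = (\<Sum>n. if e n \<le> q then (1/2::real) ^ n else 0)" for q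
  have summ: "summable (\<lambda>n. if Q n then (1/2::real) ^ n else 0)" for Q
    by (rule summable_comparison_test'[of "\<lambda>n. (1/2::real) ^ n" 0])
      (auto intro: summable_geometric)
  have lo_hi: "lo q < hi q" for q
  proof -
    have sums: "summable (\<lambda>n. (if e n \<le> q then (1/2::real) ^ n else 0) - (if e n < q then (1/2) ^ n else 0))"
      by (intro summable_diff summ)
    have "0 < (\<Sum>n. (if e n \<le> q then (1/2::real) ^ n else 0) - (if e n < q then (1/2) ^ n else 0))"
      by (rule suminf_pos2[OF sums, of "to_nat q"]) (auto simp: e_def)
    then show ?thesis
      unfolding lo_def hi_def by (simp add: suminf_diff[OF summ summ, symmetric])
  qed
  have hi_lo: "hi p \<le> lo q" if "p < q" for p q
    unfolding lo_def hi_def using that by (intro suminf_le summ) auto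
  have "\<exists>a b. lo q < of_rat a \<and> a < b \<and> of_rat b < hi q" for q
  proof -
    obtain a where a: "lo q < of_rat a" "of_rat a < hi q"
      using of_rat_dense[OF lo_hi] by blast
    moreover obtain b where "of_rat a < (of_rat b :: real)" "of_rat b < hi q"
      using of_rat_dense[OF a(2)] by blast
    ultimately show ?thesis by (auto simp: of_rat_less)
  qed
  then obtain a b where ab: "\<And>q. lo q < of_rat (a q) \<and> a q < b q \<and> of_rat (b q) < hi q"
    by metis
  have "b p < a q" if "p < q" for p q
  proof -
    have "(of_rat (b p) :: real) < of_rat (a q)"
      using ab[of p] ab[of q] hi_lo[OF that] by linarith
    then show ?thesis by (simp add: of_rat_less)
  qed
  with ab that show thesis by blast
qed

section \<open>Lexicographic combinations of total preorders\<close>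

text \<open>Reflexivity on \<open>A\<close> is the case \<open>x = y\<close> of the last
  clause.\<close>

definition total_preorder_on :: "'a set \<Rightarrow> 'a rel \<Rightarrow> bool" where
  "total_preorder_on A R \<longleftrightarrow>
     R \<subseteq> A \<times> A \<and> trans R \<and> (\<forall>x \<in> A. \<forall>y \<in> A. (x, y) \<in> R \<or> (y, x) \<in> R)"

lemma total_preorder_on_if_linear_order_on:
  "linear_order_on A R \<Longrightarrow> total_preorder_on A R"
  unfolding linear_order_on_def partial_order_on_def preorder_on_def total_preorder_on_def
    total_on_def refl_on_def
  by metis

lemma linear_order_on_if_total_preorder_on:
  "total_preorder_on A R \<Longrightarrow> antisym R \<Longrightarrow> linear_order_on A R"
  unfolding linear_order_on_def partial_order_on_def preorder_on_def total_preorder_on_def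
    total_on_def refl_on_def
  by metis

lemma total_preorder_on_converse:
  "total_preorder_on A R \<Longrightarrow> total_preorder_on A (R\<inverse>)"
  unfolding total_preorder_on_def by auto

lemma total_preorder_on_inv_image:
  assumes "total_preorder_on B R" "g ` A \<subseteq> B"
  shows "total_preorder_on A ((A \<times> A) \<inter> inv_image R g)"
proof -
  have "trans (inv_image R g)"
    using assms(1) by (simp add: total_preorder_on_def trans_inv_image)
  then have "trans ((A \<times> A) \<inter> inv_image R g)"
    unfolding trans_def by blast
  then show ?thesis
    using assms unfolding total_preorder_on_def by (auto simp: image_subset_iff)
qed

definition lex_rel :: "'a rel \<Rightarrow> 'a rel \<Rightarrow> 'a rel" where
  "lex_rel R S = {(x, y) \<in> R. (y, x) \<in> R \<longrightarrow> (x, y) \<in> S}"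

lemma total_preorder_on_lex_rel:
  assumes "total_preorder_on A R" "total_preorder_on A S"
  shows "total_preorder_on A (lex_rel R S)"
proof -
  have "trans (lex_rel R S)"
  proof (rule transI)
    have "trans R" "trans S" using assms by (auto simp: total_preorder_on_def)
    fix x y z assume "(x, y) \<in> lex_rel R S" "(y, z) \<in> lex_rel R S"
    then show "(x, z) \<in> lex_rel R S"
      using \<open>trans R\<close> \<open>trans S\<close> unfolding lex_rel_def by (auto dest: transD)
  qed
  then show ?thesis
    using assms unfolding total_preorder_on_def lex_rel_def by blast
qed

text \<open>If \<open>f a\<close> and \<open>f b\<close> tie in \<open>R\<close> for some
  \<open>a < b\<close>, transitivity ties everything between them, so \<open>S\<close> decides
  there, and the interval holds a copy of the rationals. Otherwise \<open>f\<close> is strict for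
  \<open>R\<close>.\<close>

lemma rat_embeds_lex_rel:
  assumes "trans R" "rat_embeds (lex_rel R S)"
  shows "rat_embeds R \<or> rat_embeds S"
proof -
  obtain f :: "rat \<Rightarrow> 'a" where f:
    "\<And>p q. p < q \<Longrightarrow> (f p, f q) \<in> lex_rel R S \<and> (f q, f p) \<notin> lex_rel R S"
    using assms(2) unfolding rat_embeds_def by blast
  have R: "(f p, f q) \<in> R" if "p < q" for p q
    using f[OF that] by (simp add: lex_rel_def)
  show ?thesis
  proof (cases "\<exists>a b. a < b \<and> (f b, f a) \<in> R")
    case True
    then obtain a b where ab: "a < b" "(f b, f a) \<in> R" by blast
    obtain g :: "rat \<Rightarrow> rat" where g: "strict_mono g" "\<And>q. a < g q \<and> g q < b"
      using rat_strict_mono_into_interval[OF ab(1)] by blast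
    have "rat_embeds S"
    proof (rule rat_embedsI)
      fix p q :: rat assume "p < q"
      then have lt: "g p < g q" using g(1) by (simp add: strict_mono_less)
      have "(f (g q), f (g p)) \<in> R"
        using R g(2) ab(2) \<open>trans R\<close> by (meson transD)
      then show "((f \<circ> g) p, (f \<circ> g) q) \<in> S \<and> ((f \<circ> g) q, (f \<circ> g) p) \<notin> S"
        using f[OF lt] by (auto simp: lex_rel_def)
    qed
    then show ?thesis ..
  next
    case False
    then show ?thesis using R rat_embedsI[of f R] by blast
  qed
qed

text \<open>The base \<open>A \<times> A\<close> ties all points of \<open>A\<close>, so it decides
  nothing.\<close>

definition lex_list :: "'a set \<Rightarrow> 'a rel list \<Rightarrow> 'a rel" where
  "lex_list A Rs = foldr lex_rel Rs (A \<times> A)"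

lemma lex_list_simps [simp]:
  "lex_list A [] = A \<times> A"
  "lex_list A (R # Rs) = lex_rel R (lex_list A Rs)"
  by (simp_all add: lex_list_def)

lemma total_preorder_on_lex_list:
  "(\<And>R. R \<in> set Rs \<Longrightarrow> total_preorder_on A R) \<Longrightarrow> total_preorder_on A (lex_list A Rs)"
proof (induction Rs)
  case Nil
  show ?case by (auto simp: total_preorder_on_def trans_def)
qed (simp add: total_preorder_on_lex_rel)

lemma not_rat_embeds_lex_list:
  "(\<And>R. R \<in> set Rs \<Longrightarrow> trans R \<and> \<not> rat_embeds R) \<Longrightarrow> \<not> rat_embeds (lex_list A Rs)"
proof (induction Rs)
  case Nil
  show ?case
    using zero_less_one unfolding rat_embeds_def lex_list_simps by blast
next
  case (Cons R Rs)
  then show ?case using rat_embeds_lex_rel by fastforce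
qed

text \<open>A comparison that holds both ways is never decided, so it passes through every
  component. Antisymmetry of the combined orders rests on this.\<close>

lemma lex_list_symD:
  "(x, y) \<in> lex_list A Rs \<Longrightarrow> (y, x) \<in> lex_list A Rs \<Longrightarrow> R \<in> set Rs \<Longrightarrow> (x, y) \<in> R"
  by (induction Rs) (auto simp: lex_rel_def)

lemma lex_listI:
  "x \<in> A \<Longrightarrow> y \<in> A \<Longrightarrow> (\<And>R. R \<in> set Rs \<Longrightarrow> (x, y) \<in> R) \<Longrightarrow> (x, y) \<in> lex_list A Rs"
  by (induction Rs) (auto simp: lex_rel_def)

section \<open>From the poset to its split\<close>

lemma finite_scattered_dim_split:
  assumes "finite_scattered_dim P r"
  shows "finite_scattered_dim (split_carrier P) (split_order P r)"
proof -
  let ?B = "split_carrier P"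
  obtain \<L> where fin: "finite \<L>" and ne: "\<L> \<noteq> {}"
    and lin: "\<And>L. L \<in> \<L> \<Longrightarrow> linear_order_on P L"
    and scat: "\<And>L. L \<in> \<L> \<Longrightarrow> scattered_on P L" and r: "r = \<Inter>\<L>"
    using assms unfolding finite_scattered_dim_def by blast
  obtain L0 where L0: "L0 \<in> \<L>" using ne by blast
  define F where "F L = (?B \<times> ?B) \<inter> inv_image L fst" for L :: "'a rel"
  define N where "N = (?B \<times> ?B) \<inter> inv_image {(i, j). i \<le> j} snd"
  define M where "M L = lex_rel (F L) N" for L
  \<comment> \<open>On a common level \<open>K\<close> reverses \<open>L0\<close> while
    \<open>M L0\<close> follows it, so distinct points of one level are incomparable in the
    intersection.\<close>
  define K where "K = lex_rel N (F (L0\<inverse>))"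
  have tF: "total_preorder_on ?B (F L)" if "total_preorder_on P L" for L
    unfolding F_def by (rule total_preorder_on_inv_image[OF that]) (auto simp: split_carrier_def)
  have tN: "total_preorder_on ?B N"
    unfolding N_def total_preorder_on_def inv_image_def trans_def by auto
  have tp: "total_preorder_on P L" if "L \<in> \<L>" for L
    using lin[OF that] by (rule total_preorder_on_if_linear_order_on)
  have anti: "antisym L" if "L \<in> \<L>" for L
    using lin[OF that] by (auto simp: linear_order_on_def partial_order_on_def)
  have reflL: "(x, x) \<in> L" if "L \<in> \<L>" "x \<in> P" for L x
    using tp[OF that(1)] that(2) unfolding total_preorder_on_def by blast
  have nL: "\<not> rat_embeds L" if "L \<in> \<L>" for L
    using scattered_on_iff_not_rat_embeds[OF lin[OF that]] scat[OF that] by blast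
  have nF: "\<not> rat_embeds (F L)" if "\<not> rat_embeds L" for L
    using that unfolding F_def by (blast dest: rat_embeds_inv_image)
  have nN: "\<not> rat_embeds N"
  proof
    assume "rat_embeds N"
    then obtain f :: "rat \<Rightarrow> 'a \<times> nat" where
      f: "\<And>p q. p < q \<Longrightarrow> (f p, f q) \<in> N \<and> (f q, f p) \<notin> N"
      unfolding rat_embeds_def by blast
    have "snd (f p) < snd (f q) \<and> snd (f q) \<le> 1" if "p < q" for p q
      using f[OF that] unfolding N_def inv_image_def split_carrier_def by auto
    \<comment> \<open>With only two levels there is no strict chain of three points.\<close>
    from this[of 0 1] this[of 1 2] show False by simp
  qed
  have linM: "linear_order_on ?B (M L)" if "L \<in> \<L>" for L
  proof (rule linear_order_on_if_total_preorder_on)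
    show "total_preorder_on ?B (M L)"
      unfolding M_def by (intro total_preorder_on_lex_rel tF tN tp that)
    show "antisym (M L)"
      using anti[OF that] unfolding M_def lex_rel_def F_def N_def inv_image_def antisym_def
      by force
  qed
  have linK: "linear_order_on ?B K"
  proof (rule linear_order_on_if_total_preorder_on)
    show "total_preorder_on ?B K"
      unfolding K_def
      by (intro total_preorder_on_lex_rel tF tN total_preorder_on_converse tp L0)
    show "antisym K"
      using anti[OF L0] unfolding K_def lex_rel_def F_def N_def inv_image_def antisym_def
      by force
  qed
  have scM: "scattered_on ?B (M L)" if "L \<in> \<L>" for L
  proof -
    have "trans (F L)" using tF[OF tp[OF that]] by (simp add: total_preorder_on_def)
    then have "\<not> rat_embeds (M L)"
      unfolding M_def using rat_embeds_lex_rel nF[OF nL[OF that]] nN by blast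
    then show ?thesis by (simp add: scattered_on_iff_not_rat_embeds[OF linM[OF that]])
  qed
  have scK: "scattered_on ?B K"
  proof -
    have "trans N" using tN by (simp add: total_preorder_on_def)
    moreover have "\<not> rat_embeds (F (L0\<inverse>))"
      using nF rat_embeds_converse nL[OF L0] by blast
    ultimately have "\<not> rat_embeds K"
      unfolding K_def using rat_embeds_lex_rel nN by blast
    then show ?thesis by (simp add: scattered_on_iff_not_rat_embeds[OF linK])
  qed
  have "split_order P r = \<Inter> (insert K (M ` \<L>))"
  proof (intro set_eqI iffI)
    fix u assume "u \<in> split_order P r"
    then obtain x i y j where u: "u = ((x, i), (y, j))" and B: "(x, i) \<in> ?B" "(y, j) \<in> ?B"
      and xy: "(x, i) = (y, j) \<or> (x, y) \<in> r \<and> i < j"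
      unfolding split_order_def by blast
    have P: "x \<in> P" "y \<in> P" using B by (auto simp: split_carrier_def)
    have "u \<in> M L" if L: "L \<in> \<L>" for L
      using xy B r L reflL[OF L P(1)]
      unfolding u M_def lex_rel_def F_def N_def inv_image_def by auto
    moreover have "u \<in> K"
      using xy B reflL[OF L0 P(1)]
      unfolding u K_def lex_rel_def F_def N_def inv_image_def by auto
    ultimately show "u \<in> \<Inter> (insert K (M ` \<L>))" by blast
  next
    fix u assume u: "u \<in> \<Inter> (insert K (M ` \<L>))"
    obtain x i y j where uu: "u = ((x, i), (y, j))" by (metis surj_pair)
    have K: "((x, i), (y, j)) \<in> K" and M: "\<And>L. L \<in> \<L> \<Longrightarrow> ((x, i), (y, j)) \<in> M L"
      using u uu by auto
    have B: "(x, i) \<in> ?B" "(y, j) \<in> ?B"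
      using K unfolding K_def lex_rel_def N_def by auto
    have xy: "(x, y) \<in> L" if "L \<in> \<L>" for L
      using M[OF that] unfolding M_def lex_rel_def F_def inv_image_def by auto
    have ij: "i < j \<or> i = j \<and> (y, x) \<in> L0"
      using K B unfolding K_def lex_rel_def F_def N_def inv_image_def by auto
    have "i < j \<or> (x, i) = (y, j)"
      using ij xy[OF L0] anti[OF L0] by (auto dest: antisymD)
    then show "u \<in> split_order P r"
      using B xy r unfolding uu split_order_def by blast
  qed
  moreover have "finite (insert K (M ` \<L>))" using fin by simp
  ultimately show ?thesis
    unfolding finite_scattered_dim_def
    using partial_order_on_split[of P r] linM linK scM scK
    by (intro conjI exI[of _ "insert K (M ` \<L>)"]) auto
qed

section \<open>From the split to the poset\<close>

text \<open>
  Inclusion of \<open>D(x)\<close> in \<open>D(y)\<close>, where \<open>D(x)\<close> is the initial segment generated by the image under \<open>g\<close>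
  of the down-set of \<open>x\<close>.
\<close>

definition cut_rel :: "'a set \<Rightarrow> 'a rel \<Rightarrow> ('a \<Rightarrow> 'b) \<Rightarrow> 'b rel \<Rightarrow> 'a rel" where
  "cut_rel P r g L = {(x, y) \<in> P \<times> P. \<forall>z. (z, x) \<in> r \<longrightarrow> (\<exists>w. (w, y) \<in> r \<and> (g z, g w) \<in> L)}"

context
  fixes P :: "'a set" and r :: "'a rel" and A :: "'b set" and L :: "'b rel" and g :: "'a \<Rightarrow> 'b"
  assumes r: "r \<subseteq> P \<times> P" and L: "linear_order_on A L" and g: "g ` P \<subseteq> A"
begin

text \<open>A failure of inclusion provides a point outside the segment of \<open>y\<close>;
  totality of \<open>L\<close> places it strictly above that whole segment.\<close>

lemma cut_rel_not_le:
  assumes "x \<in> P" "y \<in> P" "(x, y) \<notin> cut_rel P r g L"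
  obtains z where "(z, x) \<in> r" "\<And>w. (w, y) \<in> r \<Longrightarrow> (g w, g z) \<in> L \<and> (g z, g w) \<notin> L"
proof -
  obtain z where z: "(z, x) \<in> r" "\<And>w. (w, y) \<in> r \<Longrightarrow> (g z, g w) \<notin> L"
    using assms unfolding cut_rel_def by blast
  have "(g w, g z) \<in> L" if "(w, y) \<in> r" for w
  proof -
    have "g w \<in> A" "g z \<in> A" using that z(1) r g by auto
    then show ?thesis
      using z(2)[OF that] total_preorder_on_if_linear_order_on[OF L]
      unfolding total_preorder_on_def by blast
  qed
  with z that show thesis by blast
qed

text \<open>Initial segments of a chain are nested, so inclusion compares any two.\<close>

lemma total_preorder_on_cut_rel: "total_preorder_on P (cut_rel P r g L)"
proof -
  have "trans L" using L by (simp add: linear_order_on_def partial_order_on_def preorder_on_def)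
  have "trans (cut_rel P r g L)"
  proof (rule transI)
    fix x y z assume xy: "(x, y) \<in> cut_rel P r g L" and yz: "(y, z) \<in> cut_rel P r g L"
    have "\<exists>w. (w, z) \<in> r \<and> (g v, g w) \<in> L" if v: "(v, x) \<in> r" for v
    proof -
      obtain u where u: "(u, y) \<in> r" "(g v, g u) \<in> L" using xy v unfolding cut_rel_def by blast
      then obtain w where "(w, z) \<in> r" "(g u, g w) \<in> L" using yz unfolding cut_rel_def by blast
      with u \<open>trans L\<close> show ?thesis by (meson transD)
    qed
    with xy yz show "(x, z) \<in> cut_rel P r g L" unfolding cut_rel_def by blast
  qed
  moreover have "(y, x) \<in> cut_rel P r g L" if xy: "x \<in> P" "y \<in> P" "(x, y) \<notin> cut_rel P r g L" for x y
  proof -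
    obtain z where "(z, x) \<in> r" "\<And>w. (w, y) \<in> r \<Longrightarrow> (g w, g z) \<in> L \<and> (g z, g w) \<notin> L"
      using cut_rel_not_le[OF xy] by blast
    then show ?thesis using xy unfolding cut_rel_def by blast
  qed
  moreover have "cut_rel P r g L \<subseteq> P \<times> P"
    by (auto simp: cut_rel_def)
  ultimately show ?thesis
    unfolding total_preorder_on_def by blast
qed

text \<open>The segment for \<open>b q\<close> exceeds the one for \<open>a q\<close> by some
  \<open>g (c q)\<close>. For \<open>p < q\<close> the segment for \<open>b p\<close> lies inside
  the one for \<open>a q\<close>, so \<open>g (c p)\<close> is strictly below
  \<open>g (c q)\<close>.\<close>

lemma rat_embeds_cut_rel:
  assumes "rat_embeds (cut_rel P r g L)"
  shows "rat_embeds L"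
proof -
  let ?C = "cut_rel P r g L"
  obtain f :: "rat \<Rightarrow> 'a" where f: "\<And>p q. p < q \<Longrightarrow> (f p, f q) \<in> ?C \<and> (f q, f p) \<notin> ?C"
    using assms unfolding rat_embeds_def by blast
  have P: "f q \<in> P" for q
    using f[of q "q + 1"] by (simp add: cut_rel_def)
  have "trans L" using L by (simp add: linear_order_on_def partial_order_on_def preorder_on_def)
  obtain a b :: "rat \<Rightarrow> rat" where ab: "\<And>q. a q < b q" "\<And>p q. p < q \<Longrightarrow> b p < a q"
    using rat_disjoint_intervals by blast
  have "\<exists>z. (z, f (b q)) \<in> r \<and> (\<forall>w. (w, f (a q)) \<in> r \<longrightarrow> (g w, g z) \<in> L \<and> (g z, g w) \<notin> L)" for q
    using cut_rel_not_le[OF P P, of "b q" "a q"] f[OF ab(1)[of q]] by metis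
  then obtain c where c: "\<And>q. (c q, f (b q)) \<in> r"
    "\<And>q w. (w, f (a q)) \<in> r \<Longrightarrow> (g w, g (c q)) \<in> L \<and> (g (c q), g w) \<notin> L"
    by metis
  show ?thesis
  proof (rule rat_embedsI)
    fix p q :: rat assume "p < q"
    have "(f (b p), f (a q)) \<in> ?C" using f ab(2)[OF \<open>p < q\<close>] by blast
    then obtain w where w: "(w, f (a q)) \<in> r" "(g (c p), g w) \<in> L"
      using c(1)[of p] unfolding cut_rel_def by blast
    show "((g \<circ> c) p, (g \<circ> c) q) \<in> L \<and> ((g \<circ> c) q, (g \<circ> c) p) \<notin> L"
      using w c(2)[OF w(1)] \<open>trans L\<close> unfolding comp_def by (meson transD)
  qed
qed

end

lemma finite_scattered_dim_if_split:
  assumes po: "partial_order_on P r"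
    and "finite_scattered_dim (split_carrier P) (split_order P r)"
  shows "finite_scattered_dim P r"
proof -
  let ?B = "split_carrier P"
  obtain \<L> where fin: "finite \<L>" and ne: "\<L> \<noteq> {}"
    and lin: "\<And>L. L \<in> \<L> \<Longrightarrow> linear_order_on ?B L"
    and scat: "\<And>L. L \<in> \<L> \<Longrightarrow> scattered_on ?B L" and split: "split_order P r = \<Inter>\<L>"
    using assms(2) unfolding finite_scattered_dim_def by blast
  obtain Ls where Ls: "set Ls = \<L>" using finite_list[OF fin] by blast
  have rP: "r \<subseteq> P \<times> P" and refl: "\<And>x. x \<in> P \<Longrightarrow> (x, x) \<in> r" and "trans r" and "antisym r"
    using po by (auto simp: partial_order_on_def preorder_on_def refl_on_def)
  define g :: "'a \<Rightarrow> 'a \<times> nat" where "g x = (x, 0)" for x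
  have g: "g ` P \<subseteq> ?B" by (auto simp: g_def split_carrier_def)
  define C where "C = cut_rel P r g"
  \<comment> \<open>The leading \<open>C L\<close> ensures that \<open>M L\<close> is contained in
    \<open>C L\<close>; the common tail over all of \<open>Ls\<close> breaks the remaining ties and
    makes \<open>M L\<close> antisymmetric.\<close>
  define M where "M L = lex_list P (map C (L # Ls))" for L
  have tC: "total_preorder_on P (C L)" if "L \<in> \<L>" for L
    unfolding C_def by (rule total_preorder_on_cut_rel[OF rP lin[OF that] g])
  have nC: "\<not> rat_embeds (C L)" if "L \<in> \<L>" for L
    using rat_embeds_cut_rel[OF rP lin[OF that] g] scat[OF that]
      scattered_on_iff_not_rat_embeds[OF lin[OF that]]
    unfolding C_def by blast
  have rC: "(x, y) \<in> C L" if "(x, y) \<in> r" "L \<in> \<L>" for x y L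
  proof -
    have "(z, y) \<in> r \<and> (g z, g z) \<in> L" if "(z, x) \<in> r" for z
    proof -
      have "g z \<in> ?B" using that rP g by auto
      then have "(g z, g z) \<in> L"
        using total_preorder_on_if_linear_order_on[OF lin[OF \<open>L \<in> \<L>\<close>]]
        unfolding total_preorder_on_def by blast
      then show ?thesis using that \<open>(x, y) \<in> r\<close> \<open>trans r\<close> by (meson transD)
    qed
    with that rP show ?thesis unfolding C_def cut_rel_def by blast
  qed
  have Cr: "(x, y) \<in> r" if xy: "x \<in> P" "y \<in> P" and C: "\<And>L. L \<in> \<L> \<Longrightarrow> (x, y) \<in> C L" for x y
  proof (rule ccontr)
    assume "(x, y) \<notin> r"
    then have "((x, 0), (y, 1)) \<notin> split_order P r" by (simp add: split_order_def)
    then obtain L where L: "L \<in> \<L>" "((x, 0), (y, 1)) \<notin> L" using split by blast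
    have yx: "((y, 1), (x, 0)) \<in> L"
      using total_preorder_on_if_linear_order_on[OF lin[OF L(1)]] L(2) xy
      unfolding total_preorder_on_def split_carrier_def by blast
    \<comment> \<open>The test point is \<open>x\<close> itself. Since \<open>(w, 0)\<close> is
      below \<open>(y, 1)\<close> in the split, transitivity puts \<open>(x, 0)\<close> below
      \<open>(y, 1)\<close> in \<open>L\<close>, a contradiction.\<close>
    obtain w where w: "(w, y) \<in> r" "((x, 0), (w, 0)) \<in> L"
      using C[OF L(1)] refl[OF xy(1)] unfolding C_def cut_rel_def g_def by blast
    have "((w, 0), (y, 1)) \<in> split_order P r"
      using w(1) rP by (auto simp: split_order_def split_carrier_def)
    then have "((w, 0), (y, 1)) \<in> L" using split L(1) by blast
    moreover have "trans L"
      using lin[OF L(1)] by (simp add: linear_order_on_def partial_order_on_def preorder_on_def)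
    ultimately have "((x, 0), (y, 1)) \<in> L" using w(2) by (meson transD)
    with L(2) show False ..
  qed
  have linM: "linear_order_on P (M L)" if "L \<in> \<L>" for L
  proof (rule linear_order_on_if_total_preorder_on)
    show t: "total_preorder_on P (M L)"
      unfolding M_def using tC Ls that by (intro total_preorder_on_lex_list) auto
    show "antisym (M L)"
    proof (rule antisymI)
      fix x y assume xy: "(x, y) \<in> M L" "(y, x) \<in> M L"
      then have "x \<in> P" "y \<in> P" using t unfolding total_preorder_on_def by auto
      moreover have "(x, y) \<in> C L'" "(y, x) \<in> C L'" if "L' \<in> \<L>" for L'
        using lex_list_symD[OF xy[unfolded M_def]] lex_list_symD[OF xy(2,1)[unfolded M_def]] that Ls
        by auto
      ultimately show "x = y" using Cr \<open>antisym r\<close> by (meson antisymD)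
    qed
  qed
  have scM: "scattered_on P (M L)" if "L \<in> \<L>" for L
  proof -
    have "\<not> rat_embeds (M L)"
      unfolding M_def using tC nC Ls that
      by (intro not_rat_embeds_lex_list) (auto simp: total_preorder_on_def)
    then show ?thesis by (simp add: scattered_on_iff_not_rat_embeds[OF linM[OF that]])
  qed
  have "r = \<Inter> (M ` \<L>)"
  proof (intro set_eqI iffI)
    fix u assume "u \<in> r"
    then show "u \<in> \<Inter> (M ` \<L>)"
      using rC rP Ls unfolding M_def by (cases u) (auto intro!: lex_listI simp del: lex_list_simps)
  next
    fix u assume u: "u \<in> \<Inter> (M ` \<L>)"
    have "u \<in> C L" if "L \<in> \<L>" for L
      using u that unfolding M_def by (auto simp: lex_rel_def)
    \<comment> \<open>The family being nonempty, some \<open>C L\<close> is available, and it is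
      contained in \<open>P \<times> P\<close>.\<close>
    moreover have "u \<in> P \<times> P"
      using calculation ne unfolding C_def cut_rel_def by blast
    ultimately show "u \<in> r" using Cr by (cases u) auto
  qed
  then show ?thesis
    unfolding finite_scattered_dim_def using po fin ne linM scM
    by (intro conjI exI[of _ "M ` \<L>"]) auto
qed

theorem theorem2:
  fixes P :: "'a set" and r :: "'a rel"
  assumes "partial_order_on P r"
  shows "finite_scattered_dim P r \<longleftrightarrow>
         finite_scattered_dim (split_carrier P) (split_order P r)"
  using assms finite_scattered_dim_split finite_scattered_dim_if_split by blast

end
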